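(* Let $J_3:\mathbb{N}\to\mathbb{N}$ be the Josephus function with reduction constant $3$, and let $\{n_p^{(\ell)}\}_{\ell\in\mathbb{N}}$ be the strictly increasing enumeration of the fixed points of $J_3$ (so $n_p^{(1)}=1$). For each $\ell$, let $\overline{m}_\ell$ denote the number of pure high extremal points $n$ of $J_3$ with $n_p^{(\ell)}<n<n_p^{(\ell+1)}$. Then for each $\ell\in\mathbb{N}$, \[ \overline{m}_\ell=\max\{m\in\mathbb{Z}_{\ge 0} : 2^m \text{ divides } 3n_p^{(\ell)}+2\}, \] and \[ n_p^{(\ell+1)}=\frac{3^{\overline{m}_\ell}\,(3n_p^{(\ell)}+2)-2^{\overline{m}_\ell}}{2^{\overline{m}_\ell+1}}. \]
   Context: The Josephus function $J_3$: for $n\in\mathbb{N}=\{1,2,\dots\}$, place $n$ people numbered $1,\dots,n$ clockwise in a circle; starting the count at person $1$ and proceeding clockwise, eliminate every third person (the first eliminated is person $3$), the circle closing ranks after each elimination, until one person remains; $J_3(n)$ is the original number of the survivor. Equivalently $J_3(1)=1$ and $J_3(n)=((J_3(n-1)+2)\bmod n)+1$ for $n\ge 2$. A positive integer $n$ is a fixed point of $J_3$ if $J_3(n)=n$, and a pure high extremal point if $J_3(n)=n-1$. (It is known that $J_3$ has infinitely many fixed points.) *)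

theory Defs
  imports Complex_Main "HOL-Library.Infinite_Set"
begin

text \<open>
  The circle is a list read clockwise, whose head is the person at which the count (re)starts.
  Counting off two people moves them to the end of the list; the third one, now at the head, is
  eliminated.  If only two people are left the count wraps around, and so does \<^const>\<open>rotate\<close>.
\<close>

function josephus3_survivor :: "'a list \<Rightarrow> 'a" where
  "josephus3_survivor xs =
     (if length xs \<le> 1 then hd xs else josephus3_survivor (tl (rotate 2 xs)))"
  by auto
termination
  by (relation "measure length") auto

declare josephus3_survivor.simps [simp del]

definition J3 :: "nat \<Rightarrow> nat" where
  "J3 n = josephus3_survivor [1..<n + 1]"

definition J3_fixed_points :: "nat set" where
  "J3_fixed_points = {n. n \<ge> 1 \<and> J3 n = n}"

definition J3_pure_high_points :: "nat set" where
  "J3_pure_high_points = {n. n \<ge> 1 \<and> J3 n = n - 1}"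

text \<open>
  The enumeration is indexed by \<open>l \<ge> 1\<close>, whereas \<^const>\<open>enumerate\<close> starts at 0.
\<close>

definition n_p :: "nat \<Rightarrow> nat" where
  "n_p l = enumerate J3_fixed_points (l - 1)"

definition m_bar :: "nat \<Rightarrow> nat" where
  "m_bar l = card {n \<in> J3_pure_high_points. n_p l < n \<and> n < n_p (l + 1)}"

lemma josephus3_survivor_map:
  "xs \<noteq> [] \<Longrightarrow> josephus3_survivor (map f xs) = f (josephus3_survivor xs)"
proof (induction xs rule: josephus3_survivor.induct)
  case (1 xs)
  show ?case
  proof (cases "length xs \<le> 1")
    case True
    with "1.prems" show ?thesis
      by (simp add: josephus3_survivor.simps[of xs] josephus3_survivor.simps[of "map f xs"] hd_map)
  next
    case False
    then have "length (tl (rotate 2 xs)) > 0"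
      by simp
    then have "tl (rotate 2 xs) \<noteq> []"
      by (metis length_greater_0_conv)
    with "1.IH" False show ?thesis
      by (simp add: josephus3_survivor.simps[of xs] josephus3_survivor.simps[of "map f xs"]
          rotate_map flip: map_tl)
  qed
qed

lemma J3_1: "J3 1 = 1"
  by (simp add: J3_def josephus3_survivor.simps)

lemma J3_rec:
  assumes "n \<ge> 2"
  shows "J3 n = (J3 (n - 1) + 2) mod n + 1"
proof -
  have "tl (rotate 2 [1..<n + 1]) = map (\<lambda>i. (i + 2) mod n + 1) [1..<n]"
  proof (rule nth_equalityI)
    show "length (tl (rotate 2 [1..<n + 1])) = length (map (\<lambda>i. (i + 2) mod n + 1) [1..<n])"
      by (simp del: upt_Suc)
  next
    fix i assume "i < length (tl (rotate 2 [1..<n + 1]))"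
    then have i: "i < n - 1"
      by (simp del: upt_Suc)
    have "tl (rotate 2 [1..<n + 1]) ! i = rotate 2 [1..<n + 1] ! Suc i"
      using i by (intro nth_tl) (simp del: upt_Suc)
    also have "\<dots> = [1..<n + 1] ! ((2 + Suc i) mod n)"
      using i by (subst nth_rotate) (auto simp del: upt_Suc)
    also have "\<dots> = 1 + (2 + Suc i) mod n"
    proof -
      have "(2 + Suc i) mod n < n"
        using assms by simp
      then show ?thesis
        by (subst nth_upt) (auto simp del: upt_Suc)
    qed
    also have "\<dots> = map (\<lambda>i. (i + 2) mod n + 1) [1..<n] ! i"
      using i by simp
    finally show "tl (rotate 2 [1..<n + 1]) ! i = map (\<lambda>i. (i + 2) mod n + 1) [1..<n] ! i" .
  qed
  then have "J3 n = josephus3_survivor (map (\<lambda>i. (i + 2) mod n + 1) [1..<n])"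
    using assms unfolding J3_def by (subst josephus3_survivor.simps) (simp del: upt_Suc)
  also have "\<dots> = (J3 (n - 1) + 2) mod n + 1"
    using assms by (subst josephus3_survivor_map) (auto simp: J3_def simp del: upt_Suc)
  finally show ?thesis .
qed

lemma n_p_1: "n_p 1 = 1"
proof -
  have "(LEAST n. n \<in> J3_fixed_points) = 1"
    by (rule Least_equality) (use J3_1 in \<open>auto simp: J3_fixed_points_def\<close>)
  then show ?thesis
    by (simp add: n_p_def enumerate_0)
qed

end

theory Submission
  imports Defs
begin

text \<open>
  The gap \<open>n - J3 n\<close> drops by 2 at each step until it is 0 (a fixed point) or 1 (a pure high point).
  After a fixed point \<open>n\<close> it restarts at \<open>n - 1\<close>, after a pure high point \<open>n\<close> at \<open>n\<close>.
  Hence a pure high point \<open>h\<close> with \<open>h + 1\<close> even is followed by the pure high point \<open>h'\<close> with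
  \<open>h' + 1 = 3 (h + 1) / 2\<close>, and one with \<open>h + 1\<close> odd by the fixed point \<open>(3 (h + 1) - 1) / 2\<close>.
  An even fixed point \<open>n\<close> leads to the pure high point \<open>h\<close> with \<open>h + 1 = (3 n + 2) / 2\<close>, so the number
  of pure high points before the next fixed point is the 2-adic valuation of \<open>3 n + 2\<close>.
\<close>

lemma J3_Suc_of_fixed:
  assumes "n \<ge> 1" "J3 n = n"
  shows "J3 (Suc n) = 2"
proof -
  have "(n + 2) mod Suc n = 1"
    using assms(1) by (simp add: mod_if)
  then show ?thesis
    using J3_rec[of "Suc n"] assms by simp
qed

lemma J3_Suc_of_high:
  assumes "n \<ge> 1" "J3 n = n - 1"
  shows "J3 (Suc n) = 1"
  using J3_rec[of "Suc n"] assms by simp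

text \<open>The hypothesis says exactly that in the last of the \<open>k\<close> steps, hence in all
  of them, the sum \<open>J3 (n + k - 1) + 2\<close> stays below the modulus \<open>n + k\<close>;
  so the recursion never wraps and each step adds 3.\<close>

lemma J3_add:
  assumes "n \<ge> 1" "J3 n + 2 * k \<le> n"
  shows "J3 (n + k) = J3 n + 3 * k"
  using assms(2)
proof (induction k)
  case (Suc k)
  then show ?case
    using J3_rec[of "n + Suc k"] assms(1) by simp
qed simp

text \<open>After \<open>k\<close> steps the gap is \<open>n - J3 n - 2 * k\<close>, still at least
  2 here, while fixed points and pure high points have gap 0 and 1.\<close>

lemma no_special_point_before:
  assumes "n \<ge> 1" "J3 n \<le> n" "n \<le> j" "j < n + (n - J3 n) div 2"
  shows "j \<notin> J3_fixed_points" "j \<notin> J3_pure_high_points"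
proof -
  obtain k where k: "j = n + k" "k < (n - J3 n) div 2"
    using assms(3,4) by (metis le_iff_add nat_add_left_cancel_less)
  then have "J3 n + 2 * k + 2 \<le> n"
    by linarith
  then have "J3 j + 2 \<le> j"
    using J3_add[of n k] assms(1) k by simp
  then show "j \<notin> J3_fixed_points" "j \<notin> J3_pure_high_points"
    by (auto simp: J3_fixed_points_def J3_pure_high_points_def)
qed

text \<open>After \<open>(n - J3 n) div 2\<close> steps the gap has shrunk to its remainder modulo
  2.\<close>

lemma special_point_at_end:
  assumes "n \<ge> 1" "J3 n \<le> n"
  defines "p \<equiv> n + (n - J3 n) div 2"
  shows "even (n - J3 n) \<Longrightarrow> p \<in> J3_fixed_points"
    and "odd (n - J3 n) \<Longrightarrow> p \<in> J3_pure_high_points"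
proof -
  define k where "k = (n - J3 n) div 2"
  have p: "p = n + k"
    by (simp add: p_def k_def)
  have "J3 n + 2 * k \<le> n"
    using assms(2) by (simp add: k_def)
  then have J: "J3 p = J3 n + 3 * k"
    unfolding p using assms(1) by (intro J3_add)
  show "p \<in> J3_fixed_points" if "even (n - J3 n)"
  proof -
    have "n = J3 n + 2 * k"
      using that assms(2) by (simp add: k_def)
    then show ?thesis
      using assms(1) J p by (simp add: J3_fixed_points_def)
  qed
  show "p \<in> J3_pure_high_points" if "odd (n - J3 n)"
  proof -
    have "n = J3 n + 2 * k + 1"
      using odd_two_times_div_two_succ[OF that] assms(2) unfolding k_def by linarith
    then show ?thesis
      using assms(1) J p by (simp add: J3_pure_high_points_def)
  qed
qed

lemma fixed_not_high: "n \<in> J3_fixed_points \<Longrightarrow> n \<notin> J3_pure_high_points"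
  by (auto simp: J3_fixed_points_def J3_pure_high_points_def)

text \<open>Induction on the 2-adic valuation \<open>k\<close> of \<open>h + 1\<close>. Moving to
  the next pure high point trades one factor 2 for a factor 3, which \<open>q\<close> absorbs, so
  \<open>q\<close> must be arbitrary. The open interval leaves out \<open>h\<close> itself, so each
  trade contributes exactly one counted point.\<close>

lemma next_fixed_point_after_high:
  assumes "h \<in> J3_pure_high_points" "h + 1 = 2 ^ k * q" "odd q"
  shows "\<exists>p>h. p \<in> J3_fixed_points \<and> J3_fixed_points \<inter> {h<..<p} = {}
    \<and> card (J3_pure_high_points \<inter> {h<..<p}) = k \<and> 2 * p + 1 = 3 ^ (k + 1) * q"
  using assms
proof (induction k arbitrary: h q)
  case (0 h q)
  then have h: "h \<ge> 1" "even h" and J: "J3 (Suc h) = 1"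
    using J3_Suc_of_high by (auto simp: J3_pure_high_points_def)
  \<comment> \<open>The gap at \<open>Suc h\<close> is \<open>h\<close>, so the run ends
    \<open>h div 2\<close> steps later.\<close>
  let ?p = "Suc h + h div 2"
  have none: "j \<notin> J3_fixed_points \<and> j \<notin> J3_pure_high_points" if "h < j" "j < ?p" for j
    using no_special_point_before[of "Suc h" j] J that by simp
  have "?p \<in> J3_fixed_points"
    using special_point_at_end(1)[of "Suc h"] J h by simp
  moreover have "J3_fixed_points \<inter> {h<..<?p} = {}" "J3_pure_high_points \<inter> {h<..<?p} = {}"
    using none by auto
  moreover have "2 * ?p + 1 = 3 ^ (0 + 1) * q"
    using h 0 by (auto elim!: evenE)
  ultimately show ?case
    by (intro exI[of _ ?p]) simp
next
  case (Suc k h q)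
  then have "even (h + 1)"
    by simp
  then have h: "h \<ge> 1" "odd h" and J: "J3 (Suc h) = 1"
    using Suc.prems(1) J3_Suc_of_high by (auto simp: J3_pure_high_points_def)
  let ?h = "Suc h + h div 2"
  have none: "j \<notin> J3_fixed_points \<and> j \<notin> J3_pure_high_points" if "h < j" "j < ?h" for j
    using no_special_point_before[of "Suc h" j] J that by simp
  have high: "?h \<in> J3_pure_high_points"
    using special_point_at_end(2)[of "Suc h"] J h by simp
  have "2 * (?h + 1) = 3 * (h + 1)"
    using h by (auto elim!: oddE)
  also have "\<dots> = 2 * (2 ^ k * (3 * q))"
    using Suc.prems(2) by simp
  finally have "?h + 1 = 2 ^ k * (3 * q)"
    by (metis mult_cancel1 zero_neq_numeral)
  from Suc.IH[OF high this] Suc.prems(3) obtain p where p: "p > ?h" "p \<in> J3_fixed_points"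
    "J3_fixed_points \<inter> {?h<..<p} = {}" "card (J3_pure_high_points \<inter> {?h<..<p}) = k"
    "2 * p + 1 = 3 ^ (k + 1) * (3 * q)"
    by auto
  have split: "{h<..<p} = {h<..<?h} \<union> {?h} \<union> {?h<..<p}"
    using p(1) by auto
  have "J3_fixed_points \<inter> {h<..<p} = {}"
    unfolding split using p(3) none high fixed_not_high by auto
  moreover have "J3_pure_high_points \<inter> {h<..<p}
      = insert ?h (J3_pure_high_points \<inter> {?h<..<p})"
    unfolding split using high none by auto
  then have "card (J3_pure_high_points \<inter> {h<..<p}) = Suc k"
    using p(4) by simp
  ultimately show ?case
    using p by (intro exI[of _ p]) simp
qed

lemma next_fixed_point:
  assumes "n \<in> J3_fixed_points" "3 * n + 2 = 2 ^ k * q" "odd q"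
  shows "\<exists>p>n. p \<in> J3_fixed_points \<and> J3_fixed_points \<inter> {n<..<p} = {}
    \<and> card (J3_pure_high_points \<inter> {n<..<p}) = k \<and> 2 * p + 1 = 3 ^ k * q"
proof -
  have n: "n \<ge> 1" and J: "J3 (Suc n) = 2"
    using assms(1) J3_Suc_of_fixed by (auto simp: J3_fixed_points_def)
  \<comment> \<open>Here the gap at \<open>Suc n\<close> is \<open>n - 1\<close>, since
    \<open>J3 (Suc n) = 2\<close>.\<close>
  let ?p = "Suc n + (n - 1) div 2"
  have none: "j \<notin> J3_fixed_points \<and> j \<notin> J3_pure_high_points" if "n < j" "j < ?p" for j
    using no_special_point_before[of "Suc n" j] J n that by simp
  show ?thesis
  proof (cases k)
    case 0
    then have "odd (3 * n + 2)"
      using assms by simp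
    then have "odd n"
      by simp
    then have "?p \<in> J3_fixed_points" "2 * ?p + 1 = 3 * n + 2"
      using special_point_at_end(1)[of "Suc n"] J n by (auto elim!: oddE)
    moreover have "J3_fixed_points \<inter> {n<..<?p} = {}" "J3_pure_high_points \<inter> {n<..<?p} = {}"
      using none by auto
    ultimately show ?thesis
      using 0 assms(2) by (intro exI[of _ ?p]) simp
  next
    case (Suc k')
    then have "even (3 * n + 2)"
      using assms by simp
    then have "even n"
      by simp
    then have high: "?p \<in> J3_pure_high_points" and "2 * (?p + 1) = 3 * n + 2"
      using special_point_at_end(2)[of "Suc n"] J n by (auto elim!: evenE)
    \<comment> \<open>Only \<open>k'\<close> factors 2 remain, giving \<open>k'\<close> pure high
      points beyond \<open>?p\<close>; counting \<open>?p\<close> as well restores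
      \<open>k\<close>.\<close>
    then have "?p + 1 = 2 ^ k' * q"
      using assms(2) Suc by simp
    from next_fixed_point_after_high[OF high this assms(3)] obtain p where
      p: "p > ?p" "p \<in> J3_fixed_points" "J3_fixed_points \<inter> {?p<..<p} = {}"
        "card (J3_pure_high_points \<inter> {?p<..<p}) = k'" "2 * p + 1 = 3 ^ (k' + 1) * q"
      by auto
    have split: "{n<..<p} = {n<..<?p} \<union> {?p} \<union> {?p<..<p}"
      using p(1) by auto
    have "J3_fixed_points \<inter> {n<..<p} = {}"
      unfolding split using p(3) none high fixed_not_high by auto
    moreover have "J3_pure_high_points \<inter> {n<..<p}
        = insert ?p (J3_pure_high_points \<inter> {?p<..<p})"
      unfolding split using high none by auto
    then have "card (J3_pure_high_points \<inter> {n<..<p}) = k"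
      using p(4) Suc by simp
    ultimately show ?thesis
      using p Suc by (intro exI[of _ p]) simp
  qed
qed

lemma odd_part_decomposition:
  fixes x :: nat
  assumes "x > 0"
  shows "\<exists>k q. x = 2 ^ k * q \<and> odd q"
  using assms
proof (induction x rule: less_induct)
  case (less x)
  show ?case
  proof (cases "even x")
    case True
    then obtain y where y: "x = 2 * y" "0 < y" "y < x"
      using less.prems by (auto elim!: evenE)
    with less.IH obtain k q where "y = 2 ^ k * q" "odd q"
      by blast
    then show ?thesis
      using y by (intro exI[of _ "Suc k"] exI[of _ q]) simp
  next
    case False
    then show ?thesis
      by (intro exI[of _ 0] exI[of _ x]) simp
  qed
qed

lemma Max_power_two_dvd:
  fixes q :: nat
  assumes "odd q"
  shows "Max {m. 2 ^ m dvd 2 ^ k * q} = k"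
proof -
  have "m \<le> k" if "2 ^ m dvd 2 ^ k * q" for m
  proof (rule ccontr)
    assume "\<not> m \<le> k"
    then have "(2::nat) ^ Suc k dvd 2 ^ m"
      by (intro le_imp_power_dvd) simp
    then have "2 ^ k * 2 dvd 2 ^ k * q"
      using that by (metis dvd_trans power_Suc2)
    then show False
      using assms by simp
  qed
  \<comment> \<open>Being an initial segment, the set is finite, so \<open>Max\<close> really is its
    maximum.\<close>
  then have "{m. 2 ^ m dvd 2 ^ k * q} = {..k}"
    by (auto intro: dvd_mult2 le_imp_power_dvd)
  then show ?thesis
    by (simp add: Max_eq_iff)
qed

text \<open>A largest fixed point would have a successor by \<open>next_fixed_point\<close>.
  Infinitude ensures that \<open>enumerate\<close> stays inside the set at every index.\<close>

lemma infinite_J3_fixed_points: "infinite J3_fixed_points"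
proof
  assume fin: "finite J3_fixed_points"
  have "1 \<in> J3_fixed_points"
    using J3_1 by (simp add: J3_fixed_points_def)
  then have M: "Max J3_fixed_points \<in> J3_fixed_points"
    using fin by (intro Max_in) auto
  obtain k q where "3 * Max J3_fixed_points + 2 = 2 ^ k * q" "odd q"
    using odd_part_decomposition[of "3 * Max J3_fixed_points + 2"] by auto
  from next_fixed_point[OF M this] obtain p where "p > Max J3_fixed_points" "p \<in> J3_fixed_points"
    by auto
  then show False
    using fin by (meson Max_ge leD)
qed

theorem theorem3:
  fixes l :: nat
  assumes "l \<ge> 1"
  shows "m_bar l = Max {m :: nat. 2 ^ m dvd 3 * n_p l + 2}
    \<and> real (n_p (l + 1)) =
        (3 ^ m_bar l * (3 * real (n_p l) + 2) - 2 ^ m_bar l) / 2 ^ (m_bar l + 1)"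
proof -
  have fp: "n_p l \<in> J3_fixed_points"
    unfolding n_p_def using infinite_J3_fixed_points by (rule enumerate_in_set)
  obtain k q where kq: "3 * n_p l + 2 = 2 ^ k * q" "odd q"
    using odd_part_decomposition[of "3 * n_p l + 2"] by auto
  from next_fixed_point[OF fp this] obtain p where
    p: "p > n_p l" "p \<in> J3_fixed_points" "J3_fixed_points \<inter> {n_p l<..<p} = {}"
      "card (J3_pure_high_points \<inter> {n_p l<..<p}) = k" "2 * p + 1 = 3 ^ k * q"
    by auto
  have "n_p (l + 1) = enumerate J3_fixed_points (Suc (l - 1))"
    using assms by (simp add: n_p_def)
  also have "\<dots> = (LEAST s. s \<in> J3_fixed_points \<and> n_p l < s)"
    using enumerate_Suc''[OF infinite_J3_fixed_points] by (simp add: n_p_def)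
  \<comment> \<open>Minimality holds because no fixed point lies strictly between
    \<open>n_p l\<close> and \<open>p\<close>.\<close>
  also have "\<dots> = p"
    using p(1-3) by (intro Least_equality) (auto simp: not_le[symmetric])
  finally have np: "n_p (l + 1) = p" .
  have "{n \<in> J3_pure_high_points. n_p l < n \<and> n < p} = J3_pure_high_points \<inter> {n_p l<..<p}"
    by auto
  then have m: "m_bar l = k"
    unfolding m_bar_def np using p(4) by simp
  have "2 * real p + 1 = 3 ^ k * real q"
    using arg_cong[OF p(5), of real] by simp
  then have rp: "real p = (3 ^ k * real q - 1) / 2"
    by simp
  have x: "3 * real (n_p l) + 2 = 2 ^ k * real q"
    using arg_cong[OF kq(1), of real] by simp
  \<comment> \<open>This is \<open>(3 ^ k * q - 1) / 2\<close> with numerator and denominator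
    multiplied by \<open>2 ^ k\<close>.\<close>
  have "real p = (3 ^ k * (3 * real (n_p l) + 2) - 2 ^ k) / 2 ^ (k + 1)"
    unfolding rp x by (simp add: field_simps)
  then show ?thesis
    using m np kq Max_power_two_dvd by simp
qed

end
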